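(* Let $\alpha\in\{0,1,2\}^\omega$ contain infinitely many $1$s or infinitely many $2$s. Then there exists an $\mathrm{MSO}$ interpretation $\Theta$ such that $\Theta(\mathcal{S}_\alpha)$ contains (isomorphic copies of) all square grids.
   Context: For $\alpha=\alpha_0\alpha_1\cdots\in\{0,1,2\}^\omega$, $\mathcal{P}_\alpha$ is the infinite graph with vertex set $\{v_{i,j}: i,j\in\mathbb{N}\}$, where there is no edge between $v_{i,j}$ and $v_{i',j'}$ unless $|j-j'|=1$, and edges between consecutive columns are given by: if $\alpha_j=0$, $\{v_{i,j},v_{k,j+1}\}$ is an edge iff $i=k$; if $\alpha_j=1$, iff $i\ne k$; if $\alpha_j=2$, iff $i\le k$. $\mathcal{S}_\alpha$ is the class of all finite induced subgraphs of $\mathcal{P}_\alpha$. An $\mathrm{MSO}$ interpretation with parameters $\bar Z=(Z_1,\dots,Z_l)$ (set variables) is a tuple $\Psi(\bar Z)=(\psi(x,\bar Z),\psi_E(x,y,\bar Z))$ of $\mathrm{MSO}$ formulas over the graph vocabulary; for a graph $G$ and subsets $\bar A$ of $V(G)$, $\Psi((G,\bar A))$ is the structure with vertex set $\{a:G\models\psi(a,\bar A)\}$ and edge relation $\{(a,b):G\models\psi_E(a,b,\bar A)\}$, and $\Psi(\mathcal{C})=\{\Psi((G,\bar A)): G\in\mathcal{C}, \bar A \text{ arbitrary}\}$. The $n\times n$ grid has vertices $(i,j)$, $1\le i,j\le n$, with $(i,j)$ adjacent to $(i,j+1)$ and $(i+1,j)$ when these exist. *)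

theory Defs
  imports "Graph_Theory.Graph_Theory"
begin

text \<open>
  A structure over the graph vocabulary (one binary relation symbol) is a
  \<^typ>\<open>'v pair_pre_digraph\<close>; an undirected graph has both orientations of every edge among
  its arcs.
\<close>

subsection \<open>Monadic second-order logic of graphs\<close>

text \<open>
  Vertex variables and set variables are named by natural numbers, in separate name spaces.
  Missing connectives and the universal quantifiers are expressed by the given ones.
\<close>

datatype mso =
    Eq nat nat
  | Edge nat nat
  | Mem nat nat  \<comment> \<open>vertex variable, set variable\<close>
  | Neg mso
  | Conj mso mso
  | ExV nat mso
  | ExS nat mso

primrec free_v :: "mso \<Rightarrow> nat set" where
  "free_v (Eq x y) = {x, y}"
| "free_v (Edge x y) = {x, y}"
| "free_v (Mem x X) = {x}"
| "free_v (Neg \<phi>) = free_v \<phi>"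
| "free_v (Conj \<phi> \<psi>) = free_v \<phi> \<union> free_v \<psi>"
| "free_v (ExV x \<phi>) = free_v \<phi> - {x}"
| "free_v (ExS X \<phi>) = free_v \<phi>"

primrec free_s :: "mso \<Rightarrow> nat set" where
  "free_s (Eq x y) = {}"
| "free_s (Edge x y) = {}"
| "free_s (Mem x X) = {X}"
| "free_s (Neg \<phi>) = free_s \<phi>"
| "free_s (Conj \<phi> \<psi>) = free_s \<phi> \<union> free_s \<psi>"
| "free_s (ExV x \<phi>) = free_s \<phi>"
| "free_s (ExS X \<phi>) = free_s \<phi> - {X}"

primrec sat :: "'v pair_pre_digraph \<Rightarrow> (nat \<Rightarrow> 'v) \<Rightarrow> (nat \<Rightarrow> 'v set) \<Rightarrow> mso \<Rightarrow> bool" where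
  "sat G e E (Eq x y) \<longleftrightarrow> e x = e y"
| "sat G e E (Edge x y) \<longleftrightarrow> (e x, e y) \<in> parcs G"
| "sat G e E (Mem x X) \<longleftrightarrow> e x \<in> E X"
| "sat G e E (Neg \<phi>) \<longleftrightarrow> \<not> sat G e E \<phi>"
| "sat G e E (Conj \<phi> \<psi>) \<longleftrightarrow> sat G e E \<phi> \<and> sat G e E \<psi>"
| "sat G e E (ExV x \<phi>) \<longleftrightarrow> (\<exists>a \<in> pverts G. sat G (e(x := a)) E \<phi>)"
| "sat G e E (ExS X \<phi>) \<longleftrightarrow> (\<exists>A. A \<subseteq> pverts G \<and> sat G e (E(X := A)) \<phi>)"

lemma sat_cong_free:
  assumes "\<And>x. x \<in> free_v \<phi> \<Longrightarrow> e x = e' x" "\<And>X. X \<in> free_s \<phi> \<Longrightarrow> E X = E' X"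
  shows "sat G e E \<phi> \<longleftrightarrow> sat G e' E' \<phi>"
  using assms
proof (induction \<phi> arbitrary: e e' E E')
  case (Conj \<phi> \<psi>)
  have "sat G e E \<phi> = sat G e' E' \<phi>" by (rule Conj.IH) (use Conj.prems in auto)
  moreover have "sat G e E \<psi> = sat G e' E' \<psi>" by (rule Conj.IH) (use Conj.prems in auto)
  ultimately show ?case by simp
next
  case (Neg \<phi>)
  have "sat G e E \<phi> = sat G e' E' \<phi>" by (rule Neg.IH) (use Neg.prems in auto)
  then show ?case by simp
next
  case (ExV x \<phi>)
  have "sat G (e(x := a)) E \<phi> = sat G (e'(x := a)) E' \<phi>" for a
    by (rule ExV.IH) (use ExV.prems in auto)
  then show ?case by simp
next
  case (ExS X \<phi>)
  have "sat G e (E(X := A)) \<phi> = sat G e' (E'(X := A)) \<phi>" for A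
    by (rule ExS.IH) (use ExS.prems in auto)
  then show ?case by simp
qed simp_all


subsection \<open>Interpretations with set parameters\<close>

record mso_interpretation =
  arity :: nat
  dom_fm :: mso
  edge_fm :: mso

text \<open>
  The set variables below \<^term>\<open>arity \<Psi>\<close> are the parameters. The domain formula
  has the free vertex variable 0, the edge formula the free vertex variables 0 and 1.
\<close>

definition is_mso_interpretation :: "mso_interpretation \<Rightarrow> bool" where
  "is_mso_interpretation \<Psi> \<longleftrightarrow>
     free_v (dom_fm \<Psi>) \<subseteq> {0} \<and> free_s (dom_fm \<Psi>) \<subseteq> {..<arity \<Psi>} \<and>
     free_v (edge_fm \<Psi>) \<subseteq> {0, 1} \<and> free_s (edge_fm \<Psi>) \<subseteq> {..<arity \<Psi>}"

text \<open>
  By \<open>sat_cong_free\<close>, the values of the assignments outside the declared free variables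
  are irrelevant. The edge relation is restricted to the domain, so that the result is again a
  structure.
\<close>

definition interp ::
  "mso_interpretation \<Rightarrow> 'v pair_pre_digraph \<Rightarrow> 'v set list \<Rightarrow> 'v pair_pre_digraph" where
  "interp \<Psi> G As =
     (let V = {a \<in> pverts G. sat G (\<lambda>_. a) (\<lambda>i. As ! i) (dom_fm \<Psi>)}
      in \<lparr> pverts = V,
           parcs = {(a, b) \<in> V \<times> V.
             sat G (\<lambda>x. if x = 0 then a else b) (\<lambda>i. As ! i) (edge_fm \<Psi>)} \<rparr>)"

definition interp_class ::
  "mso_interpretation \<Rightarrow> 'v pair_pre_digraph set \<Rightarrow> 'v pair_pre_digraph set" where
  "interp_class \<Psi> \<C> =
     {interp \<Psi> G As | G As.
        G \<in> \<C> \<and> length As = arity \<Psi> \<and> (\<forall>A \<in> set As. A \<subseteq> pverts G)}"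


subsection \<open>The graphs of a word over 0, 1, 2\<close>

definition column_edge :: "(nat \<Rightarrow> nat) \<Rightarrow> nat \<Rightarrow> nat \<Rightarrow> nat \<Rightarrow> bool" where
  "column_edge \<alpha> j i k \<longleftrightarrow>
     \<alpha> j = 0 \<and> i = k \<or> \<alpha> j = 1 \<and> i \<noteq> k \<or> \<alpha> j = 2 \<and> i \<le> k"

text \<open>The vertex in row \<open>i\<close> and column \<open>j\<close> is the pair \<open>(i, j)\<close>.\<close>

definition P_graph :: "(nat \<Rightarrow> nat) \<Rightarrow> (nat \<times> nat) pair_pre_digraph" where
  "P_graph \<alpha> = \<lparr> pverts = UNIV,
     parcs = {((i, j), (i', j')).
       j' = j + 1 \<and> column_edge \<alpha> j i i' \<or> j = j' + 1 \<and> column_edge \<alpha> j' i' i} \<rparr>"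

definition S_class :: "(nat \<Rightarrow> nat) \<Rightarrow> (nat \<times> nat) pair_pre_digraph set" where
  "S_class \<alpha> =
     {G. finite (pverts G) \<and> induced_subgraph (with_proj G) (with_proj (P_graph \<alpha>))}"


subsection \<open>Square grids\<close>

definition grid :: "nat \<Rightarrow> (nat \<times> nat) pair_pre_digraph" where
  "grid n = \<lparr> pverts = {1..n} \<times> {1..n},
     parcs = {((i, j), (i', j')) \<in> ({1..n} \<times> {1..n}) \<times> ({1..n} \<times> {1..n}).
       i = i' \<and> (j' = j + 1 \<or> j = j' + 1) \<or> j = j' \<and> (i' = i + 1 \<or> i = i' + 1)} \<rparr>"

end

theory Submission
  imports Defs "HOL-Library.Infinite_Set"
begin

text \<open>
  Take a large rectangle of \<open>P_graph \<alpha>\<close>. Colouring the columns modulo 3 orients its edges from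
  left to right. The neighbour of a vertex in the same row and the next column is then definable:
  after a letter 1 it is the only non-neighbour in the next column, otherwise the least neighbour.
  Hence ``further right in the same row'' is the MSO-definable transitive closure. In columns with
  a letter 1 or 2, being in the same column means having a common right neighbour. Choose
  \<open>2n\<close> such columns. The first \<open>n\<close> of them carry the grid vertices, which gives
  the horizontal edges as consecutive grid vertices of a row. Each of the others serves one
  \<open>i\<close>: it records that the rows \<open>i\<close> and \<open>i + 1\<close> are consecutive, by two colours marking its
  vertices in these rows.
\<close>

section \<open>Derived connectives\<close>

definition Disj :: "mso \<Rightarrow> mso \<Rightarrow> mso" where
  "Disj \<phi> \<psi> = Neg (Conj (Neg \<phi>) (Neg \<psi>))"

definition Imp :: "mso \<Rightarrow> mso \<Rightarrow> mso" where
  "Imp \<phi> \<psi> = Neg (Conj \<phi> (Neg \<psi>))"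

definition AllV :: "nat \<Rightarrow> mso \<Rightarrow> mso" where
  "AllV x \<phi> = Neg (ExV x (Neg \<phi>))"

definition AllS :: "nat \<Rightarrow> mso \<Rightarrow> mso" where
  "AllS X \<phi> = Neg (ExS X (Neg \<phi>))"

lemma sat_derived [simp]:
  "sat G e E (Disj \<phi> \<psi>) \<longleftrightarrow> sat G e E \<phi> \<or> sat G e E \<psi>"
  "sat G e E (Imp \<phi> \<psi>) \<longleftrightarrow> (sat G e E \<phi> \<longrightarrow> sat G e E \<psi>)"
  "sat G e E (AllV x \<phi>) \<longleftrightarrow> (\<forall>a \<in> pverts G. sat G (e(x := a)) E \<phi>)"
  "sat G e E (AllS X \<phi>) \<longleftrightarrow> (\<forall>A. A \<subseteq> pverts G \<longrightarrow> sat G e (E(X := A)) \<phi>)"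
  by (auto simp: Disj_def Imp_def AllV_def AllS_def)

lemma free_v_derived [simp]:
  "free_v (Disj \<phi> \<psi>) = free_v \<phi> \<union> free_v \<psi>"
  "free_v (Imp \<phi> \<psi>) = free_v \<phi> \<union> free_v \<psi>"
  "free_v (AllV x \<phi>) = free_v \<phi> - {x}"
  "free_v (AllS X \<phi>) = free_v \<phi>"
  by (auto simp: Disj_def Imp_def AllV_def AllS_def)

lemma free_s_derived [simp]:
  "free_s (Disj \<phi> \<psi>) = free_s \<phi> \<union> free_s \<psi>"
  "free_s (Imp \<phi> \<psi>) = free_s \<phi> \<union> free_s \<psi>"
  "free_s (AllV x \<phi>) = free_s \<phi>"
  "free_s (AllS X \<phi>) = free_s \<phi> - {X}"
  by (auto simp: Disj_def Imp_def AllV_def AllS_def)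

section \<open>The formulas of the interpretation\<close>

text \<open>
  Set variables 0, 1, 2 are the columns modulo 3, 3 the columns with letter 1, 4 the grid vertices,
  5 and 6 the lower and upper marks of the pairs of consecutive rows; 7 is a bound variable.
\<close>

definition fwd_fm :: "nat \<Rightarrow> nat \<Rightarrow> mso" where
  "fwd_fm x y = Conj (Edge x y)
     (Disj (Conj (Mem x 0) (Mem y 1)) (Disj (Conj (Mem x 1) (Mem y 2)) (Conj (Mem x 2) (Mem y 0))))"

text \<open>
  After a letter 1, a zigzag \<open>x \<rightarrow> w \<leftarrow> u \<rightarrow> y\<close> certifies that the non-neighbour \<open>y\<close> lies in the next
  column. Otherwise \<open>y\<close> is required to be the least neighbour of \<open>x\<close>, expressed through left
  neighbourhoods; for a letter 0 this condition is vacuous.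
\<close>

definition succ_fm :: "nat \<Rightarrow> nat \<Rightarrow> mso" where
  "succ_fm x y = (let u = x + y + 1; w = x + y + 2 in Disj
     (Conj (Mem x 3) (Conj (Neg (fwd_fm x y))
       (ExV u (ExV w (Conj (fwd_fm x w) (Conj (fwd_fm u w) (fwd_fm u y)))))))
     (Conj (Neg (Mem x 3)) (Conj (fwd_fm x y)
       (AllV u (AllV w (Imp (Conj (fwd_fm x w) (fwd_fm u y)) (fwd_fm u w)))))))"

text \<open>Reflexive transitive closure in MSO: \<open>y\<close> lies in every successor-closed set
  containing \<open>x\<close>. Rebinding 0 and 1 is harmless, as \<open>x\<close> and
  \<open>y\<close> occur only outside those quantifiers.\<close>

definition row_fm :: "nat \<Rightarrow> nat \<Rightarrow> mso" where
  "row_fm x y = AllS 7 (Imp (Conj (Mem x 7)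
     (AllV 0 (AllV 1 (Imp (Conj (Mem 0 7) (succ_fm 0 1)) (Mem 1 7))))) (Mem y 7))"

text \<open>The index \<open>x + y + 1\<close> exceeds both \<open>x\<close> and \<open>y\<close>,
  so the bound variable captures neither.\<close>

definition samecol_fm :: "nat \<Rightarrow> nat \<Rightarrow> mso" where
  "samecol_fm x y = (let w = x + y + 1 in ExV w (Conj (fwd_fm x w) (fwd_fm y w)))"

definition horiz_fm :: "nat \<Rightarrow> nat \<Rightarrow> mso" where
  "horiz_fm x y = (let z = x + y + 1 in Conj (row_fm x y) (Conj (Neg (Eq x y))
     (AllV z (Imp (Conj (Mem z 4) (Conj (row_fm x z) (row_fm z y))) (Disj (Eq z x) (Eq z y))))))"

definition vert_fm :: "nat \<Rightarrow> nat \<Rightarrow> mso" where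
  "vert_fm x y = (let u = x + y + 1; v = x + y + 2 in Conj (samecol_fm x y)
     (ExV u (ExV v (Conj (Conj (Mem u 5) (Mem v 6))
       (Conj (samecol_fm u v) (Conj (row_fm x u) (row_fm y v)))))))"

definition grid_interp :: mso_interpretation where
  "grid_interp = \<lparr> arity = 7, dom_fm = Mem 0 4,
     edge_fm = Disj (Disj (horiz_fm 0 1) (horiz_fm 1 0)) (Disj (vert_fm 0 1) (vert_fm 1 0)) \<rparr>"

lemma is_mso_interpretation_grid_interp: "is_mso_interpretation grid_interp"
  by (auto simp: is_mso_interpretation_def grid_interp_def horiz_fm_def vert_fm_def row_fm_def
      samecol_fm_def succ_fm_def fwd_fm_def Let_def)

section \<open>Meaning of the formulas in a finite rectangle\<close>

locale rectangle =
  fixes \<alpha> :: "nat \<Rightarrow> nat" and m M :: nat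
  assumes letters: "range \<alpha> \<subseteq> {0, 1, 2}" and rows: "m \<ge> 3"
begin

definition V :: "(nat \<times> nat) set" where
  "V = {..<m} \<times> {..M}"

definition R :: "(nat \<times> nat) pair_pre_digraph" where
  "R = \<lparr> pverts = V, parcs = parcs (P_graph \<alpha>) \<inter> V \<times> V \<rparr>"

text \<open>Only the parameters 0 to 3 are fixed, so the property survives reassigning the bound set
  variable 7.\<close>

definition coloured :: "(nat \<Rightarrow> (nat \<times> nat) set) \<Rightarrow> bool" where
  "coloured E \<longleftrightarrow> (\<forall>r < 3. E r = {v \<in> V. snd v mod 3 = r}) \<and> E 3 = {v \<in> V. \<alpha> (snd v) = 1}"

definition fwd :: "nat \<times> nat \<Rightarrow> nat \<times> nat \<Rightarrow> bool" where
  "fwd a b \<longleftrightarrow> snd b = Suc (snd a) \<and> column_edge \<alpha> (snd a) (fst a) (fst b)"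

lemma pverts_R [simp]: "pverts R = V"
  by (simp add: R_def)

lemma R_in_S_class: "R \<in> S_class \<alpha>"
  by (auto simp: S_class_def R_def V_def P_graph_def induced_subgraph_def subgraph_def
      compatible_def wf_digraph_def)

lemma coloured_upd [simp]: "k > 3 \<Longrightarrow> coloured (E(k := A)) \<longleftrightarrow> coloured E"
  by (auto simp: coloured_def)

lemma sat_fwd [simp]:
  assumes "coloured E" "e x \<in> V" "e y \<in> V"
  shows "sat R e E (fwd_fm x y) \<longleftrightarrow> fwd (e x) (e y)"
proof -
  obtain i j i' j' where e: "e x = (i, j)" "e y = (i', j')"
    by (metis surj_pair)
  have E: "E 0 = {v \<in> V. snd v mod 3 = 0}" "E (Suc 0) = {v \<in> V. snd v mod 3 = 1}"
    "E 2 = {v \<in> V. snd v mod 3 = 2}"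
    using assms(1) by (auto simp: coloured_def)
  \<comment> \<open>Modulo 3 a step to the left never looks like a step to the right; with two
    colours it would.\<close>
  have "\<not> (j = Suc j' \<and> (j mod 3 = 0 \<and> j' mod 3 = 1 \<or> j mod 3 = 1 \<and> j' mod 3 = 2
      \<or> j mod 3 = 2 \<and> j' mod 3 = 0))"
    by presburger
  moreover have "j' = Suc j \<Longrightarrow> (j mod 3 = 0 \<and> j' mod 3 = 1 \<or> j mod 3 = 1 \<and> j' mod 3 = 2
      \<or> j mod 3 = 2 \<and> j' mod 3 = 0)"
    by presburger
  ultimately show ?thesis
    using assms(2,3) unfolding fwd_fm_def
    by (auto simp: e E R_def P_graph_def fwd_def)
qed

lemma letter_cases: "\<alpha> j = 0 \<or> \<alpha> j = 1 \<or> \<alpha> j = 2"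
  using letters by (auto simp: image_subset_iff)

text \<open>Under letter 1, a row avoiding two given ones yields common neighbours; three rows
  suffice.\<close>

lemma ex_other_row: "\<exists>k < m. k \<noteq> i \<and> k \<noteq> i'"
proof -
  have "card {i, i'} < card {..<m}"
    using rows by (auto simp: card_insert_if)
  then have "\<not> {..<m} \<subseteq> {i, i'}"
    by (metis card_mono finite.emptyI finite_insert not_le)
  then show ?thesis by auto
qed

lemma sat_succ:
  assumes "coloured E" "e x \<in> V" "e y \<in> V"
  shows "sat R e E (succ_fm x y) \<longleftrightarrow> fst (e y) = fst (e x) \<and> snd (e y) = Suc (snd (e x))"
proof -
  obtain i j i' j' where e: "e x = (i, j)" "e y = (i', j')"
    by (metis surj_pair)
  have V: "i < m" "i' < m" "j \<le> M" "j' \<le> M"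
    using assms e by (auto simp: V_def)
  have col: "e x \<in> E 3 \<longleftrightarrow> \<alpha> j = 1"
    using assms e by (auto simp: coloured_def)
  have "sat R e E (succ_fm x y) \<longleftrightarrow>
    (if \<alpha> j = 1 then \<not> fwd (e x) (e y) \<and> (\<exists>u \<in> V. \<exists>w \<in> V. fwd (e x) w \<and> fwd u w \<and> fwd u (e y))
     else fwd (e x) (e y) \<and> (\<forall>u \<in> V. \<forall>w \<in> V. fwd (e x) w \<and> fwd u (e y) \<longrightarrow> fwd u w))"
    using assms by (simp add: succ_fm_def Let_def col cong: bex_cong_simp ball_cong_simp)
  also have "\<dots> \<longleftrightarrow> i' = i \<and> j' = Suc j"
  proof (cases "\<alpha> j = 1")
    case True
    \<comment> \<open>The rows \<open>i\<close>, \<open>k\<close>, \<open>l\<close> are distinct, so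
      all three edges of the zigzag exist under letter 1.\<close>
    have "\<exists>u \<in> V. \<exists>w \<in> V. fwd (e x) w \<and> fwd u w \<and> fwd u (e y)" if "i' = i" "j' = Suc j"
    proof -
      obtain k where k: "k < m" "k \<noteq> i" using ex_other_row by blast
      obtain l where l: "l < m" "l \<noteq> i" "l \<noteq> k" using ex_other_row by blast
      show ?thesis
        by (rule bexI[of _ "(k, j)"], rule bexI[of _ "(l, j')"])
          (use V that k l True in \<open>auto simp: fwd_def e column_edge_def V_def\<close>)
    qed
    with True show ?thesis
      by (auto simp: fwd_def e column_edge_def)
  next
    case False
    have "i' = i" if "fwd (e x) (e y)" "\<forall>u \<in> V. \<forall>w \<in> V. fwd (e x) w \<and> fwd u (e y) \<longrightarrow> fwd u w"
    proof -
      \<comment> \<open>Letters 0 and 2 join equal rows, so minimality applies to the left neighbour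
        in row \<open>i'\<close> and the right neighbour in row \<open>i\<close>. For letter 2 this
        gives \<open>i' \<le> i\<close>, against \<open>i \<le> i'\<close> from the edge
        itself.\<close>
      have "fwd (i', j) (i, j')"
        using that(2)[rule_format, of "(i', j)" "(i, j')"] that(1) V False letter_cases[of j]
        by (auto simp: fwd_def e column_edge_def V_def)
      with that(1) False show ?thesis
        by (auto simp: fwd_def e column_edge_def)
    qed
    with False letter_cases[of j] show ?thesis
      by (auto simp: fwd_def e column_edge_def)
  qed
  finally show ?thesis by (simp add: e)
qed

lemma sat_row [simp]:
  assumes "coloured E" "e x \<in> V" "e y \<in> V"
  shows "sat R e E (row_fm x y) \<longleftrightarrow> fst (e x) = fst (e y) \<and> snd (e x) \<le> snd (e y)"
proof -
  define closed where "closed X \<longleftrightarrow> (\<forall>a \<in> V. \<forall>b \<in> V.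
    a \<in> X \<and> fst b = fst a \<and> snd b = Suc (snd a) \<longrightarrow> b \<in> X)" for X
  have "sat R e E (row_fm x y) \<longleftrightarrow> (\<forall>X \<subseteq> V. e x \<in> X \<and> closed X \<longrightarrow> e y \<in> X)"
    using assms by (simp add: row_fm_def sat_succ closed_def cong: ball_cong_simp)
  also have "\<dots> \<longleftrightarrow> fst (e x) = fst (e y) \<and> snd (e x) \<le> snd (e y)"
  proof
    assume "\<forall>X \<subseteq> V. e x \<in> X \<and> closed X \<longrightarrow> e y \<in> X"
    \<comment> \<open>The part of the row from \<open>e x\<close> rightwards is itself a closed
      set.\<close>
    from this[rule_format, of "{v \<in> V. fst (e x) = fst v \<and> snd (e x) \<le> snd v}"] assms
    show "fst (e x) = fst (e y) \<and> snd (e x) \<le> snd (e y)"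
      by (auto simp: closed_def)
  next
    assume *: "fst (e x) = fst (e y) \<and> snd (e x) \<le> snd (e y)"
    show "\<forall>X \<subseteq> V. e x \<in> X \<and> closed X \<longrightarrow> e y \<in> X"
    proof (intro allI impI, elim conjE)
      fix X assume X: "e x \<in> X" "closed X"
      \<comment> \<open>Walk along the row; the bound by \<open>snd (e y)\<close> keeps every
        visited vertex in \<open>V\<close>.\<close>
      have "j \<le> snd (e y) \<Longrightarrow> (fst (e y), j) \<in> X" if "snd (e x) \<le> j" for j
        using that
      proof (induction j rule: dec_induct)
        case base
        then show ?case using X(1) * by (metis prod.collapse)
      next
        case (step j)
        then show ?case
          using X(2)[unfolded closed_def, rule_format, of "(fst (e y), j)" "(fst (e y), Suc j)"]
            assms(3) by (auto simp: V_def mem_Times_iff)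
      qed
      from this[of "snd (e y)"] * show "e y \<in> X" by simp
    qed
  qed
  finally show ?thesis .
qed

text \<open>A common right neighbour needs a next column inside the rectangle and, for distinct
  rows, a letter other than 0.\<close>

lemma sat_samecol [simp]:
  assumes "coloured E" "e x \<in> V" "e y \<in> V" "snd (e x) < M" "\<alpha> (snd (e x)) \<noteq> 0"
  shows "sat R e E (samecol_fm x y) \<longleftrightarrow> snd (e x) = snd (e y)"
proof -
  obtain i j i' j' where e: "e x = (i, j)" "e y = (i', j')"
    by (metis surj_pair)
  have V: "i < m" "i' < m" "j < M" "\<alpha> j = 1 \<or> \<alpha> j = 2"
    using assms e letter_cases[of j] by (auto simp: V_def)
  have "sat R e E (samecol_fm x y) \<longleftrightarrow> (\<exists>w \<in> V. fwd (e x) w \<and> fwd (e y) w)"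
    using assms by (simp add: samecol_fm_def Let_def cong: bex_cong_simp)
  also have "\<dots> \<longleftrightarrow> j = j'"
  proof
    assume "j = j'"
    \<comment> \<open>Letter 1 asks for a row different from both, letter 2 for one above both in
      the order.\<close>
    obtain k where k: "k < m" "\<alpha> j = 1 \<longrightarrow> k \<noteq> i \<and> k \<noteq> i'" "\<alpha> j = 2 \<longrightarrow> k = max i i'"
      using V ex_other_row[of i i'] by (cases "\<alpha> j = 1") auto
    show "\<exists>w \<in> V. fwd (e x) w \<and> fwd (e y) w"
      by (rule bexI[of _ "(k, Suc j)"])
        (use k V \<open>j = j'\<close> in \<open>auto simp: fwd_def e column_edge_def V_def\<close>)
  qed (auto simp: fwd_def e)
  finally show ?thesis by (simp add: e)
qed

end

section \<open>From vertex bijections to digraph isomorphisms\<close>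

lemma digraph_iso_with_projI:
  assumes bij: "bij_betw f (pverts G) (pverts H)"
    and wf: "parcs G \<subseteq> pverts G \<times> pverts G" "parcs H \<subseteq> pverts H \<times> pverts H"
    and arc: "\<And>u v. u \<in> pverts G \<Longrightarrow> v \<in> pverts G \<Longrightarrow> (f u, f v) \<in> parcs H \<longleftrightarrow> (u, v) \<in> parcs G"
  shows "digraph_iso (with_proj G) (with_proj H)"
proof -
  \<comment> \<open>Arcs are pairs of vertices, so \<open>f\<close> determines the map on
    arcs.\<close>
  let ?h = "\<lparr> iso_verts = f, iso_arcs = map_prod f f, iso_head = snd, iso_tail = fst \<rparr>"
  have inj: "inj_on f (pverts G)" and im: "f ` pverts G = pverts H"
    using bij by (auto simp: bij_betw_def)
  have "inj_on (map_prod f f) (parcs G)"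
    using map_prod_inj_on[OF inj inj] wf(1) by (rule inj_on_subset)
  then have "pre_digraph.digraph_isomorphism (with_proj G) ?h"
    using inj wf(1) by (auto simp: pre_digraph.digraph_isomorphism_def wf_digraph_def)
  moreover have "parcs H = map_prod f f ` parcs G"
  proof (intro equalityI subsetI)
    fix a assume a: "a \<in> parcs H"
    then obtain u v where "u \<in> pverts G" "v \<in> pverts G" "a = (f u, f v)"
      using wf(2) im by blast
    with a arc show "a \<in> map_prod f f ` parcs G" by force
  qed (use wf(1) arc in auto)
  then have "with_proj H = app_iso ?h (with_proj G)"
    by (simp add: with_proj_def app_iso_def im)
  ultimately show ?thesis unfolding digraph_iso_def by blast
qed

section \<open>Choice of parameters and recovery of the grid\<close>

lemma grid_in_interp_class:
  assumes letters: "range \<alpha> \<subseteq> {0, 1, 2}" and inf: "infinite {j. \<alpha> j = l}" and l: "l \<noteq> 0"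
  shows "\<exists>H \<in> interp_class grid_interp (S_class \<alpha>). digraph_iso (with_proj H) (with_proj (grid n))"
proof -
  define c where "c = enumerate {j. \<alpha> j = l}"
  have mono: "strict_mono c"
    using inf by (simp add: c_def strict_mono_enumerate)
  have c_less [simp]: "c a < c b \<longleftrightarrow> a < b" and c_le [simp]: "c a \<le> c b \<longleftrightarrow> a \<le> b"
    and c_eq [simp]: "c a = c b \<longleftrightarrow> a = b" for a b
    using mono by (simp_all add: strict_mono_less strict_mono_less_eq strict_mono_eq)
  have \<alpha>c [simp]: "0 < \<alpha> (c k)" for k
    using enumerate_in_set[OF inf, of k] l by (simp add: c_def)
  \<comment> \<open>All chosen columns lie strictly left of \<open>c (2 * n)\<close>, so each has a
    next column; \<open>n + 3\<close> gives three rows even for small \<open>n\<close>.\<close>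
  interpret rectangle \<alpha> "n + 3" "c (2 * n)"
    by unfold_locales (use letters in auto)
  define K where "K r = {v \<in> V. snd v mod 3 = r}" for r
  define Z where "Z = {(i, c k) | i k. i < n \<and> k < n}"
  \<comment> \<open>The marks lie right of every grid column, since \<open>row_fm\<close> only
    reaches rightwards. As \<open>c\<close> is injective, a lower and an upper mark share a column
    only for the same \<open>i\<close>.\<close>
  define A where "A = {(i, c (n + i)) | i. Suc i < n}"
  define B where "B = {(Suc i, c (n + i)) | i. Suc i < n}"
  define As where "As = [K 0, K 1, K 2, {v \<in> V. \<alpha> (snd v) = 1}, Z, A, B]"
  have ZV: "Z \<subseteq> V" and AV: "A \<subseteq> V" and BV: "B \<subseteq> V"
    by (auto simp: Z_def A_def B_def V_def)
  have As_subset: "\<forall>X \<in> set As. X \<subseteq> V"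
    using ZV AV BV by (auto simp: As_def K_def)
  have As_nth: "As ! 4 = Z" "As ! 5 = A" "As ! 6 = B"
    by (simp_all add: As_def)
  have coloured: "coloured ((!) As)"
    unfolding coloured_def
  proof (intro conjI allI impI)
    fix r :: nat assume "r < 3"
    then have "r = 0 \<or> r = 1 \<or> r = 2" by linarith
    then show "As ! r = {v \<in> V. snd v mod 3 = r}"
      by (elim disjE) (simp_all add: As_def K_def)
  qed (simp add: As_def)
  have horiz: "sat R e ((!) As) (horiz_fm x y) \<longleftrightarrow> i' = i \<and> k' = Suc k"
    if e: "e x = (i, c k)" "e y = (i', c k')" and lt: "i < n" "k < n" "i' < n" "k' < n"
    for e x y i k i' k'
  proof -
    have xy: "e x \<in> V" "e y \<in> V" and xyZ: "e x \<in> Z" "e y \<in> Z"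
      using ZV e lt by (auto simp: Z_def)
    have "sat R e ((!) As) (horiz_fm x y) \<longleftrightarrow> i = i' \<and> k < k' \<and>
        (\<forall>a \<in> V. a \<in> Z \<and> fst a = i \<and> c k \<le> snd a \<and> snd a \<le> c k' \<longrightarrow> a = e x \<or> a = e y)"
      using xy coloured
      by (auto simp add: horiz_fm_def Let_def As_nth e cong: ball_cong_simp)
    also have "\<dots> \<longleftrightarrow> i' = i \<and> k' = Suc k"
    proof safe
      assume *: "k < k'"
        "\<forall>a \<in> V. a \<in> Z \<and> fst a = i' \<and> c k \<le> snd a \<and> snd a \<le> c k' \<longrightarrow> a = e x \<or> a = e y"
      \<comment> \<open>This grid vertex lies between the two and differs from \<open>e x\<close>,
        so it must be \<open>e y\<close>.\<close>
      have "(i', c (Suc k)) \<in> Z"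
        using * lt by (auto simp: Z_def)
      with *(1) *(2)[rule_format, of "(i', c (Suc k))"] ZV show "k' = Suc k"
        by (auto simp: e)
    qed (auto simp: Z_def e)
    finally show ?thesis .
  qed
  have vert: "sat R e ((!) As) (vert_fm x y) \<longleftrightarrow> i' = Suc i \<and> k' = k"
    if e: "e x = (i, c k)" "e y = (i', c k')" and lt: "i < n" "k < n" "i' < n" "k' < n"
    for e x y i k i' k'
  proof -
    have xy: "e x \<in> V" "e y \<in> V"
      using ZV e lt by (auto simp: Z_def)
    \<comment> \<open>Membership in \<open>A\<close> supplies the column bound and the nonzero
      letter that \<open>sat_samecol\<close> requires.\<close>
    have col: "sat R e' ((!) As) (samecol_fm u v) \<longleftrightarrow> snd (e' u) = snd (e' v)"
      if "e' u \<in> A" "e' v \<in> B" for e' u v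
      using that coloured AV BV by (intro sat_samecol) (auto simp: A_def)
    have "sat R e ((!) As) (vert_fm x y) \<longleftrightarrow> k = k' \<and>
        (\<exists>a \<in> V. \<exists>b \<in> V. a \<in> A \<and> b \<in> B \<and> snd a = snd b \<and> i = fst a \<and> c k \<le> snd a \<and>
          i' = fst b \<and> c k' \<le> snd b)"
      using xy coloured lt
      by (cases "k = k'") (simp_all add: vert_fm_def Let_def As_nth e col cong: bex_cong_simp conj_cong)
    also have "\<dots> \<longleftrightarrow> i' = Suc i \<and> k' = k"
    proof safe
      assume "i' = Suc i" "k' = k"
      then show "\<exists>a \<in> V. \<exists>b \<in> V. a \<in> A \<and> b \<in> B \<and> snd a = snd b \<and> i = fst a \<and> c k \<le> snd a \<and>
          Suc i = fst b \<and> c k \<le> snd b"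
        using lt AV BV by (intro bexI[of _ "(i, c (n + i))"] bexI[of _ "(Suc i, c (n + i))"])
          (auto simp: A_def B_def)
    qed (auto simp: A_def B_def)
    finally show ?thesis .
  qed
  define H where "H = interp grid_interp R As"
  have vertsH: "pverts H = Z"
    using ZV by (auto simp: H_def interp_def grid_interp_def As_nth)
  have arcsH: "((i, c k), (i', c k')) \<in> parcs H \<longleftrightarrow>
      i' = i \<and> (k' = Suc k \<or> k = Suc k') \<or> k' = k \<and> (i' = Suc i \<or> i = Suc i')"
    if "i < n" "k < n" "i' < n" "k' < n" for i k i' k'
  proof -
    let ?e = "\<lambda>x. if x = 0 then (i, c k) else (i', c k')"
    have "(i, c k) \<in> Z" "(i', c k') \<in> Z"
      using that by (auto simp: Z_def)
    with ZV have "((i, c k), (i', c k')) \<in> parcs H \<longleftrightarrow> sat R ?e ((!) As) (edge_fm grid_interp)"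
      by (auto simp: H_def interp_def grid_interp_def As_nth)
    also have "\<dots> \<longleftrightarrow> (i' = i \<and> k' = Suc k \<or> i = i' \<and> k = Suc k') \<or>
        (i' = Suc i \<and> k' = k \<or> i = Suc i' \<and> k = k')"
      using that horiz[of ?e 0 i k 1 i' k'] horiz[of ?e 1 i' k' 0 i k]
        vert[of ?e 0 i k 1 i' k'] vert[of ?e 1 i' k' 0 i k]
      by (simp add: grid_interp_def)
    finally show ?thesis by blast
  qed
  \<comment> \<open>\<open>inv c\<close> recovers the index of a chosen column; both coordinates
    shift by one because the grid starts at 1.\<close>
  define f where "f = map_prod Suc (\<lambda>j. Suc (inv c j))"
  have f: "f (i, c k) = (Suc i, Suc k)" for i k
    by (simp add: f_def inj_def)
  have "bij_betw f (pverts H) (pverts (grid n))"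
    unfolding bij_betw_def
  proof
    show "inj_on f (pverts H)"
      by (auto simp: inj_on_def vertsH Z_def f)
    have "(i, j) \<in> f ` Z" if "i \<in> {1..n}" "j \<in> {1..n}" for i j
      using that by (intro image_eqI[of _ _ "(i - 1, c (j - 1))"]) (auto simp: f Z_def)
    then show "f ` pverts H = pverts (grid n)"
      by (auto simp: vertsH grid_def) (auto simp: Z_def f)
  qed
  moreover have "parcs H \<subseteq> pverts H \<times> pverts H"
    by (auto simp: H_def interp_def Let_def)
  moreover have "parcs (grid n) \<subseteq> pverts (grid n) \<times> pverts (grid n)"
    by (auto simp: grid_def)
  moreover have "(f u, f v) \<in> parcs (grid n) \<longleftrightarrow> (u, v) \<in> parcs H"
    if "u \<in> pverts H" "v \<in> pverts H" for u v
    using that by (auto simp: vertsH Z_def f arcsH grid_def)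
  ultimately have "digraph_iso (with_proj H) (with_proj (grid n))"
    by (rule digraph_iso_with_projI)
  moreover have "H \<in> interp_class grid_interp (S_class \<alpha>)"
    using R_in_S_class As_subset
    by (auto simp: H_def interp_class_def grid_interp_def As_def intro!: exI[of _ R] exI[of _ As])
  ultimately show ?thesis by blast
qed

theorem theorem4:
  fixes \<alpha> :: "nat \<Rightarrow> nat"
  assumes "range \<alpha> \<subseteq> {0, 1, 2}"
    and "infinite {j. \<alpha> j = 1} \<or> infinite {j. \<alpha> j = 2}"
  shows "\<exists>\<Theta>. is_mso_interpretation \<Theta> \<and>
    (\<forall>n\<ge>1. \<exists>H \<in> interp_class \<Theta> (S_class \<alpha>).
       digraph_iso (with_proj H) (with_proj (grid n)))"
proof -
  \<comment> \<open>The construction treats 1 and 2 alike: any nonzero letter occurring infinitely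
    often will do.\<close>
  obtain l where "infinite {j. \<alpha> j = l}" "l \<noteq> 0"
    using assms(2) by (metis one_neq_zero zero_neq_numeral)
  then show ?thesis
    using grid_in_interp_class[OF assms(1)] is_mso_interpretation_grid_interp by blast
qed

end
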